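(* Under the standing assumption on $E$, $x^*$, $x^{(0)}$ stated in the context (with constants $\delta,M,\mu,L$), suppose the initial point satisfies $$r_0=\|x^{(0)}-x^*\|_2<\min\{\delta,\hat r\},\qquad \hat r=\frac{2\mu}{M},$$ and $\beta_n=\frac{2}{L+\mu}$ for every $n\ge 0$. Then the iterates $$x^{(n+1)}=x^{(n)}-\beta_n\Big(I-2\sum_{i=1}^k v_i^{(n)}{v_i^{(n)}}^\top\Big)\nabla E(x^{(n)})$$ converge to $x^*$ as $n\to\infty$, with $$r_n=\|x^{(n)}-x^*\|_2\le\left(1-\frac{2}{\kappa+3}\right)^n\frac{\hat r r_0}{\hat r-r_0}\quad\text{for all } n\ge 0,\qquad \kappa=\frac{L}{\mu}.$$
   Context: $E:\mathbb{R}^d\to\mathbb{R}$ is a twice differentiable function, $k$ is an integer with $1\le k\le d$, and $x^*$ is a non-degenerate index-$k$ saddle point of $E$: $\nabla E(x^* )=0$ and the Hessian $\nabla^2E(x^* )$ has exactly $k$ negative eigenvalues and no zero eigenvalue. $\|\cdot\|_2$ denotes the Euclidean norm on vectors and the induced operator norm on matrices. Standing assumption: there is $\delta>0$ such that, with $U(x^*,\delta)=\{x:\|x-x^*\|_2<\delta\}$, the initial point satisfies $x^{(0)}\in U(x^*,\delta)$ and: (i) there is a constant $M>0$ with $\|\nabla^2E(x)-\nabla^2E(y)\|_2\le M\|x-y\|_2$ for all $x,y\in U(x^*,\delta)$; (ii) there are constants $0<\mu<L$ such that for every $x\in U(x^*,\delta)$ the eigenvalues of $\nabla^2E(x)$ satisfy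 $\lambda_1\le\cdots\le\lambda_k<0<\lambda_{k+1}\le\cdots\le\lambda_d$ and $|\lambda_i|\in[\mu,L]$ for $1\le i\le d$. For each iterate $x^{(n)}$, $\lambda_1^{(n)}\le\cdots\le\lambda_d^{(n)}$ are the eigenvalues of $\nabla^2E(x^{(n)})$ with corresponding orthonormal eigenvectors $v_1^{(n)},\dots,v_d^{(n)}$; thus $v_1^{(n)},\dots,v_k^{(n)}$ are exact orthonormal eigenvectors for the $k$ smallest eigenvalues. *)

theory Defs
  imports "HOL-Analysis.Analysis"
begin

definition grad :: "(real ^ 'n \<Rightarrow> real) \<Rightarrow> real ^ 'n \<Rightarrow> real ^ 'n" where
  "grad E x = (THE D. GDERIV E x :> D)"

definition hessian :: "(real ^ 'n \<Rightarrow> real) \<Rightarrow> real ^ 'n \<Rightarrow> real ^ 'n ^ 'n" where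
  "hessian E x = jacobian (grad E) (at x)"

(* Differentiability is in the Frechet sense, on the whole space; no continuity of the
   second derivative is required. *)
definition twice_differentiable :: "(real ^ 'n \<Rightarrow> real) \<Rightarrow> bool" where
  "twice_differentiable E \<longleftrightarrow>
     (\<forall>x. E differentiable (at x)) \<and> (\<forall>x. grad E differentiable (at x))"

lemma grad_eq: "GDERIV E x :> D \<Longrightarrow> grad E x = D"
  unfolding grad_def
proof (rule the_equality)
  fix D' assume "GDERIV E x :> D" "GDERIV E x :> D'"
  then have "(\<lambda>h. inner h D) = (\<lambda>h. inner h D')"
    unfolding gderiv_def by (rule has_derivative_unique)
  then show "D' = D"
    unfolding fun_eq_iff by (simp only: vector_eq_ldot)
qed

lemma twice_differentiable_hessian:
  assumes "twice_differentiable E"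
  shows "(grad E has_derivative (\<lambda>h. hessian E x *v h)) (at x)"
  using assms by (simp add: twice_differentiable_def hessian_def flip: jacobian_works)

(* lam 1 \<le> ... \<le> lam d, d = CARD('n), are the eigenvalues of A listed with multiplicity:
   the characteristic polynomial det (t I - A) splits as the product of the t - lam i.
   Values of lam outside {1..d} are irrelevant. *)
definition eigenvalues_of :: "real ^ 'n ^ 'n \<Rightarrow> (nat \<Rightarrow> real) \<Rightarrow> bool" where
  "eigenvalues_of A lam \<longleftrightarrow>
     mono_on {1..CARD('n)} lam \<and>
     (\<forall>t. det (mat t - A) = (\<Prod>i = 1..CARD('n). (t - lam i)))"

definition orthonormal_eigensystem ::
    "real ^ 'n ^ 'n \<Rightarrow> (nat \<Rightarrow> real) \<Rightarrow> (nat \<Rightarrow> real ^ 'n) \<Rightarrow> bool" where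
  "orthonormal_eigensystem A lam v \<longleftrightarrow>
     eigenvalues_of A lam \<and>
     (\<forall>i\<in>{1..CARD('n)}. A *v v i = lam i *\<^sub>R v i) \<and>
     (\<forall>i\<in>{1..CARD('n)}. \<forall>j\<in>{1..CARD('n)}. v i \<bullet> v j = (if i = j then 1 else 0))"

definition nondegenerate_saddle :: "nat \<Rightarrow> (real ^ 'n \<Rightarrow> real) \<Rightarrow> real ^ 'n \<Rightarrow> bool" where
  "nondegenerate_saddle k E xs \<longleftrightarrow>
     grad E xs = 0 \<and>
     (\<exists>lam. eigenvalues_of (hessian E xs) lam \<and>
            card {i \<in> {1..CARD('n)}. lam i < 0} = k \<and>
            (\<forall>i\<in>{1..CARD('n)}. lam i \<noteq> 0))"

definition op_norm :: "real ^ 'n ^ 'n \<Rightarrow> real" where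
  "op_norm A = onorm ((*v) A)"

definition reflection :: "nat \<Rightarrow> (nat \<Rightarrow> real ^ 'n) \<Rightarrow> real ^ 'n ^ 'n" where
  "reflection k v =
     mat 1 - 2 *\<^sub>R (\<Sum>i = 1..k. (columnvector (v i) :: real ^ 1 ^ 'n) ** (rowvector (v i) :: real ^ 'n ^ 1))"

end

theory Submission
  imports Defs
begin

text \<open>
  In an orthonormal eigenbasis of the Hessian \<open>H\<close> at the current iterate, the reflection \<open>R\<close> flips
  the sign of exactly the \<open>k\<close> eigendirections with negative eigenvalue, so \<open>R H\<close> has the eigenvalues
  \<open>\<bar>\<lambda>\<^sub>i\<bar> \<in> [\<mu>, L]\<close>: near the saddle the iteration behaves like gradient descent on a strongly
  convex quadratic. With the step \<open>2 / (L + \<mu>)\<close>, the map \<open>I - \<beta> R H\<close> contracts by the factor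
  \<open>(L - \<mu>) / (L + \<mu>)\<close> (\<open>reflected_step_contracts\<close>). Replacing \<open>\<nabla>E(x)\<close> by \<open>H (x - x\<^sup>*)\<close> costs at
  most \<open>M / 2 \<parallel>x - x\<^sup>*\<parallel>\<^sup>2\<close>, because the Hessian is Lipschitz on the ball
  (\<open>linearization_error_le\<close>), and \<open>R\<close> does not enlarge this error. Together, with
  \<open>q = 2 \<mu> / (L + \<mu>)\<close>, the distances \<open>r\<^sub>n\<close> to the saddle satisfy
  \<open>r\<^sub>n\<^sub>+\<^sub>1 \<le> (1 - q) r\<^sub>n + (q / \<rho>) r\<^sub>n\<^sup>2\<close>, where \<open>\<rho> = 2 \<mu> / M\<close> is the convergence radius
  (\<open>saddle_search_one_step\<close>).

  For \<open>r\<^sub>n < \<rho>\<close> the right-hand side is at most \<open>r\<^sub>n\<close>, so the iterates stay in the ball. It also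
  equals \<open>r\<^sub>n (1 - s)\<close> with \<open>s = q (1 - r\<^sub>n / \<rho>) \<ge> 0\<close>, and \<open>(1 - s) (1 + s) \<le> 1\<close>; as long as the
  distances are positive, this says \<open>\<rho> / r\<^sub>n\<^sub>+\<^sub>1 - 1 \<ge> (1 + q) (\<rho> / r\<^sub>n - 1)\<close>, and hence
  \<open>\<rho> / r\<^sub>n - 1 \<ge> (1 + q)\<^sup>n (\<rho> / r\<^sub>0 - 1)\<close>. This gives the linear rate
  \<open>1 / (1 + q) = 1 - 2 / (\<kappa> + 3)\<close>, which is slightly worse than the rate \<open>1 - q\<close> of the linearized
  iteration but comes with the explicit constant \<open>\<rho> r\<^sub>0 / (\<rho> - r\<^sub>0)\<close>
  (\<open>quadratic_recursion_bound\<close>).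
\<close>

section \<open>Sorted spectra\<close>

text \<open>
  Needed because the eigenvalues that accompany the eigenvectors and those that satisfy the
  spectral bounds are given as two separate lists. The characteristic polynomial determines
  the roots as a multiset, and sorting a multiset leaves only one list. Equality as sets would not
  do: the multiplicities decide which indices carry negative eigenvalues.
\<close>

lemma eigenvalues_of_unique:
  fixes A :: "real ^ 'n ^ 'n"
  assumes "eigenvalues_of A lam" and "eigenvalues_of A l" and "i \<in> {1..CARD('n)}"
  shows "lam i = l i"
proof -
  let ?d = "CARD('n)"
  have roots: "proots (\<Prod>i = 1..?d. [:- f i, 1:]) = mset (map f [1..<Suc ?d])" for f :: "nat \<Rightarrow> real"
    by (subst proots_prod) (auto simp: sum_unfold_sum_mset  simp flip: atLeastLessThanSuc_atLeastAtMost mset_upt)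
  have "poly (\<Prod>i = 1..?d. [:- lam i, 1:]) = poly (\<Prod>i = 1..?d. [:- l i, 1:])"
    using assms(1,2) by (auto simp: eigenvalues_of_def poly_prod fun_eq_iff)
  then have "(\<Prod>i = 1..?d. [:- lam i, 1:]) = (\<Prod>i = 1..?d. [:- l i, 1:])"
    by (simp add: poly_eq_poly_eq_iff)
  then have perm: "mset (map lam [1..<Suc ?d]) = mset (map l [1..<Suc ?d])"
    by (metis roots)
  have sorted: "sorted (map f [1..<Suc ?d])" if "eigenvalues_of A f" for f
    using that unfolding eigenvalues_of_def
    by (auto simp: sorted_iff_nth_mono intro!: mono_onD[where A="{1..?d}"] simp del: upt_Suc)
  have "map lam [1..<Suc ?d] = map l [1..<Suc ?d]"
    using properties_for_sort[OF perm] sorted assms(1,2) sorted_sort_id by metis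
  then show ?thesis
    using assms(3) by (auto simp: map_eq_conv)
qed

section \<open>Operators diagonal in an orthonormal frame\<close>

text \<open>
  Orthonormal vectors are distinct and independent, and as many of them as the dimension span the
  space.
\<close>

lemma orthonormal_frame_expand:
  fixes v :: "nat \<Rightarrow> real ^ 'n"
  assumes orth: "\<And>i j. \<lbrakk>i \<in> {1..CARD('n)}; j \<in> {1..CARD('n)}\<rbrakk>
      \<Longrightarrow> v i \<bullet> v j = (if i = j then 1 else 0)"
  shows "w = (\<Sum>i = 1..CARD('n). (v i \<bullet> w) *\<^sub>R v i)"
proof -
  let ?I = "{1..CARD('n)}"
  have inj: "inj_on v ?I"
    by (intro inj_onI) (metis orth zero_neq_one)
  have pw: "pairwise orthogonal (v ` ?I)"
    by (auto simp: pairwise_def orthogonal_def orth)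
  have "0 \<notin> v ` ?I"
    using orth by (metis (no_types, lifting) imageE inner_zero_left zero_neq_one)
  then have "independent (v ` ?I)"
    by (rule pairwise_orthogonal_independent[OF pw])
  then have "UNIV \<subseteq> span (v ` ?I)"
    by (intro card_ge_dim_independent) (simp_all add: card_image[OF inj, simplified])
  then have w: "w \<in> span (v ` ?I)" by blast
  have "\<And>u. u \<in> v ` ?I \<Longrightarrow> norm u = 1"
    by (auto simp: norm_eq_1 orth)
  then have "(\<Sum>u\<in>v ` ?I. (u \<bullet> w) *\<^sub>R u) = w"
    using orthonormal_basis_expand[OF pw _ w] by (simp add: inner_commute)
  then show ?thesis
    by (simp add: sum.reindex[OF inj, simplified])
qed

text \<open>
  By Pythagoras the squared norm is the sum of the squared coordinates in the frame, and the operator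
  scales each coordinate by at most \<open>c\<close>. The estimate serves both for the reflection and for the
  reflected gradient step.
\<close>

lemma norm_diagonal_operator_le:
  fixes v :: "nat \<Rightarrow> real ^ 'n" and T :: "real ^ 'n \<Rightarrow> real ^ 'n"
  assumes orth: "\<And>i j. \<lbrakk>i \<in> {1..CARD('n)}; j \<in> {1..CARD('n)}\<rbrakk>
      \<Longrightarrow> v i \<bullet> v j = (if i = j then 1 else 0)"
    and "linear T"
    and diag: "\<And>i. i \<in> {1..CARD('n)} \<Longrightarrow> T (v i) = s i *\<^sub>R v i"
    and bound: "\<And>i. i \<in> {1..CARD('n)} \<Longrightarrow> \<bar>s i\<bar> \<le> c"
    and "0 \<le> c"
  shows "norm (T w) \<le> c * norm w"
proof -
  let ?I = "{1..CARD('n)}"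
  have unit: "norm (v i) = 1" if "i \<in> ?I" for i
    using that by (simp add: norm_eq_1 orth)
  have pyth: "(norm (\<Sum>i\<in>?I. a i *\<^sub>R v i))\<^sup>2 = (\<Sum>i\<in>?I. (a i)\<^sup>2)" for a :: "nat \<Rightarrow> real"
    by (subst norm_sum_Pythagorean)
       (auto simp: pairwise_def orthogonal_def orth unit[simplified] power_mult_distrib)
  have w: "w = (\<Sum>i\<in>?I. (v i \<bullet> w) *\<^sub>R v i)"
    by (rule orthonormal_frame_expand[OF orth])
  have "T w = (\<Sum>i\<in>?I. (v i \<bullet> w) *\<^sub>R T (v i))"
    by (subst w) (simp add: linear_sum[OF \<open>linear T\<close>] linear_scale[OF \<open>linear T\<close>])
  also have "\<dots> = (\<Sum>i\<in>?I. (s i * (v i \<bullet> w)) *\<^sub>R v i)"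
    by (intro sum.cong) (auto simp: diag mult.commute)
  finally have "(norm (T w))\<^sup>2 = (\<Sum>i\<in>?I. (s i * (v i \<bullet> w))\<^sup>2)"
    using pyth by simp
  also have "\<dots> \<le> (\<Sum>i\<in>?I. c\<^sup>2 * (v i \<bullet> w)\<^sup>2)"
    unfolding power_mult_distrib
    using bound by (intro sum_mono mult_right_mono) (auto simp: abs_le_square_iff[symmetric] \<open>0 \<le> c\<close>)
  also have "\<dots> = (c * norm w)\<^sup>2"
    using pyth[of "\<lambda>i. v i \<bullet> w", folded w] by (simp add: power_mult_distrib sum_distrib_left)
  finally show ?thesis
    by (rule power2_le_imp_le) (simp add: \<open>0 \<le> c\<close>)
qed

lemma reflection_mult_vector:
  "reflection k v *v w = w - 2 *\<^sub>R (\<Sum>i = 1..k. (v i \<bullet> w) *\<^sub>R v i)"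
proof -
  have outer: "((columnvector a :: real ^ 1 ^ 'n) ** (rowvector a :: real ^ 'n ^ 1)) *v w = (a \<bullet> w) *\<^sub>R a"
    for a w :: "real ^ 'n"
    by (simp add: vec_eq_iff matrix_vector_mult_def matrix_matrix_mult_def columnvector_def
        rowvector_def inner_vec_def sum_distrib_left sum_distrib_right mult_ac)
  have sum: "(\<Sum>i\<in>I. A i) *v w = (\<Sum>i\<in>I. A i *v w)"
    for I :: "nat set" and A :: "nat \<Rightarrow> real ^ 'n ^ 'n" and w
    by (induction I rule: infinite_finite_induct) (auto simp: matrix_vector_mult_add_rdistrib)
  show ?thesis
    by (simp add: reflection_def matrix_vector_mult_diff_rdistrib sum outer
        flip: scaleR_matrix_vector_assoc)
qed

lemma reflection_eigenvector:
  fixes v :: "nat \<Rightarrow> real ^ 'n"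
  assumes orth: "\<And>i j. \<lbrakk>i \<in> {1..CARD('n)}; j \<in> {1..CARD('n)}\<rbrakk>
      \<Longrightarrow> v i \<bullet> v j = (if i = j then 1 else 0)"
    and "k \<le> CARD('n)" and j: "j \<in> {1..CARD('n)}"
  shows "reflection k v *v v j = (if j \<le> k then - 1 else 1) *\<^sub>R v j"
proof -
  have "(\<Sum>i = 1..k. (v i \<bullet> v j) *\<^sub>R v i) = (\<Sum>i = 1..k. if i = j then v j else 0)"
    using assms by (intro sum.cong) auto
  then show ?thesis
    using j by (simp add: reflection_mult_vector sum.delta scaleR_2)
qed

lemma norm_reflection_le:
  fixes v :: "nat \<Rightarrow> real ^ 'n"
  assumes "\<And>i j. \<lbrakk>i \<in> {1..CARD('n)}; j \<in> {1..CARD('n)}\<rbrakk>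
      \<Longrightarrow> v i \<bullet> v j = (if i = j then 1 else 0)"
    and "k \<le> CARD('n)"
  shows "norm (reflection k v *v w) \<le> norm w"
  using norm_diagonal_operator_le[OF assms(1) matrix_vector_mul_linear
      reflection_eigenvector[OF assms], of 1 w] by simp

text \<open>
  On the \<open>i\<close>-th eigenvector the map acts as the scalar \<open>1 - \<beta> \<bar>\<lambda>\<^sub>i\<bar>\<close>. The step
  \<open>\<beta> = 2 / (L + \<mu>)\<close> balances the two ends of the range \<open>[\<mu>, L]\<close>, where this scalar is
  \<open>\<plusminus> (L - \<mu>) / (L + \<mu>)\<close>.
\<close>

lemma reflected_step_contracts:
  fixes A :: "real ^ 'n ^ 'n" and v :: "nat \<Rightarrow> real ^ 'n"
  assumes sys: "orthonormal_eigensystem A lam v" and "k \<le> CARD('n)"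
    and "0 < \<mu>" and "\<mu> \<le> L"
    and neg: "\<And>i. i \<in> {1..k} \<Longrightarrow> lam i < 0"
    and pos: "\<And>i. i \<in> {k+1..CARD('n)} \<Longrightarrow> 0 < lam i"
    and abs: "\<And>i. i \<in> {1..CARD('n)} \<Longrightarrow> \<bar>lam i\<bar> \<in> {\<mu>..L}"
  shows "norm (w - (2 / (L + \<mu>)) *\<^sub>R (reflection k v *v (A *v w))) \<le> (L - \<mu>) / (L + \<mu>) * norm w"
proof (rule norm_diagonal_operator_le[where v = v and s = "\<lambda>i. 1 - 2 / (L + \<mu>) * \<bar>lam i\<bar>"
      and T = "\<lambda>w. w - (2 / (L + \<mu>)) *\<^sub>R (reflection k v *v (A *v w))"])
  show orth: "v i \<bullet> v j = (if i = j then 1 else 0)"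
    if "i \<in> {1..CARD('n)}" "j \<in> {1..CARD('n)}" for i j
    using sys that unfolding orthonormal_eigensystem_def by blast
  show "linear (\<lambda>w. w - (2 / (L + \<mu>)) *\<^sub>R (reflection k v *v (A *v w)))"
    unfolding matrix_vector_mul_assoc
    by (intro linear_compose_sub linear_compose_scale_right linear_ident matrix_vector_mul_linear)
  fix i assume i: "i \<in> {1..CARD('n)}"
  have "A *v v i = lam i *\<^sub>R v i"
    using sys i unfolding orthonormal_eigensystem_def by blast
  moreover have "lam i * (if i \<le> k then - 1 else 1) = \<bar>lam i\<bar>"
    using neg[of i] pos[of i] i by auto
  ultimately have "reflection k v *v (A *v v i) = \<bar>lam i\<bar> *\<^sub>R v i"
    using reflection_eigenvector[OF orth \<open>k \<le> CARD('n)\<close> i]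
    by (simp only: matrix_vector_mult_scaleR scaleR_scaleR)
  then show "v i - (2 / (L + \<mu>)) *\<^sub>R (reflection k v *v (A *v v i))
      = (1 - 2 / (L + \<mu>) * \<bar>lam i\<bar>) *\<^sub>R v i"
    by (simp add: scaleR_diff_left)
  have "2 / (L + \<mu>) * \<mu> \<le> 2 / (L + \<mu>) * \<bar>lam i\<bar>" "2 / (L + \<mu>) * \<bar>lam i\<bar> \<le> 2 / (L + \<mu>) * L"
    using abs[OF i] \<open>0 < \<mu>\<close> \<open>\<mu> \<le> L\<close> by (auto intro!: divide_right_mono)
  moreover have "(L - \<mu>) / (L + \<mu>) = 1 - 2 / (L + \<mu>) * \<mu>" "(L - \<mu>) / (L + \<mu>) = 2 / (L + \<mu>) * L - 1"
    using \<open>0 < \<mu>\<close> \<open>\<mu> \<le> L\<close> by (auto simp: field_simps)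
  ultimately show "\<bar>1 - 2 / (L + \<mu>) * \<bar>lam i\<bar>\<bar> \<le> (L - \<mu>) / (L + \<mu>)"
    by linarith
next
  show "0 \<le> (L - \<mu>) / (L + \<mu>)"
    using \<open>0 < \<mu>\<close> \<open>\<mu> \<le> L\<close> by simp
qed

section \<open>The linearization error\<close>

text \<open>
  The factor one half comes from integrating the Lipschitz bound \<open>M t \<parallel>z - y\<parallel>\<^sup>2\<close> for the
  derivative along the segment. As this derivative need not be integrable, the integration is
  replaced by the mean value inequality, which compares \<open>t \<mapsto> f (y + t (z - y)) - t f'(y) (z - y)\<close> with the real majorant
  \<open>M \<parallel>z - y\<parallel>\<^sup>2 t\<^sup>2 / 2\<close>.
\<close>

lemma linearization_error_le:
  fixes f :: "'a::real_normed_vector \<Rightarrow> 'b::real_normed_vector"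
  assumes "convex S" and y: "y \<in> S" and z: "z \<in> S"
    and deriv: "\<And>u. u \<in> S \<Longrightarrow> (f has_derivative f' u) (at u)"
    and lip: "\<And>u h. u \<in> S \<Longrightarrow> norm (f' u h - f' y h) \<le> M * norm (u - y) * norm h"
  shows "norm (f z - f y - f' y (z - y)) \<le> M / 2 * (norm (z - y))\<^sup>2"
proof -
  define h where "h = z - y"
  define g where "g t = f (y + t *\<^sub>R h) - t *\<^sub>R f' y h" for t
  have seg: "y + t *\<^sub>R h \<in> S" if "t \<in> {0..1}" for t
    using convexD_alt[OF \<open>convex S\<close> y z, of t] that by (simp add: h_def algebra_simps)
  have g': "(g has_vector_derivative f' (y + t *\<^sub>R h) h - f' y h) (at t)"
    if "t \<in> {0..1}" for t
  proof -
    interpret bounded_linear "f' (y + t *\<^sub>R h)"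
      using deriv[OF seg[OF that]] by (rule has_derivative_bounded_linear)
    have "((\<lambda>t. f (y + t *\<^sub>R h)) has_derivative (\<lambda>s. f' (y + t *\<^sub>R h) (s *\<^sub>R h))) (at t)"
    proof (rule has_derivative_compose[where g = f and f = "\<lambda>t. y + t *\<^sub>R h"])
      show "((\<lambda>t. y + t *\<^sub>R h) has_derivative (\<lambda>s. s *\<^sub>R h)) (at t)"
        by (auto intro!: derivative_eq_intros)
      show "(f has_derivative f' (y + t *\<^sub>R h)) (at (y + t *\<^sub>R h))"
        by (rule deriv[OF seg[OF that]])
    qed
    then have "((\<lambda>t. f (y + t *\<^sub>R h)) has_vector_derivative f' (y + t *\<^sub>R h) h) (at t)"
      by (simp add: has_vector_derivative_def scaleR)
    then show ?thesis
      unfolding g_def by (auto intro!: derivative_eq_intros)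
  qed
  define \<phi> where "\<phi> t = M * (norm h)\<^sup>2 / 2 * t\<^sup>2" for t :: real
  have \<phi>': "(\<phi> has_vector_derivative M * (norm h)\<^sup>2 * t) (at t)" for t
    unfolding \<phi>_def has_real_derivative_iff_has_vector_derivative[symmetric]
    by (auto intro!: derivative_eq_intros)
  have "norm (g 1 - g 0) \<le> \<phi> 1 - \<phi> 0"
  proof (rule differentiable_bound_general)
    show "continuous_on {0..1} g"
      by (intro continuous_at_imp_continuous_on ballI has_vector_derivative_continuous[OF g'])
    show "continuous_on {0..1} \<phi>"
      by (intro continuous_at_imp_continuous_on ballI has_vector_derivative_continuous[OF \<phi>'])
    fix t :: real assume t: "0 < t" "t < 1"
    then show "(g has_vector_derivative f' (y + t *\<^sub>R h) h - f' y h) (at t)"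
      by (intro g') auto
    show "(\<phi> has_vector_derivative M * (norm h)\<^sup>2 * t) (at t)"
      by (rule \<phi>')
    show "norm (f' (y + t *\<^sub>R h) h - f' y h) \<le> M * (norm h)\<^sup>2 * t"
      using lip[OF seg, of t h] t by (simp add: power2_eq_square mult_ac)
  qed simp
  then show ?thesis
    by (simp add: g_def \<phi>_def h_def algebra_simps)
qed

section \<open>The scalar recursion\<close>

text \<open>
  For positive \<open>a\<close> and \<open>b\<close> this is \<open>(1 + q) (R / a - 1) \<le> R / b - 1\<close>, written without division
  so that iterates that hit the saddle exactly need no special treatment. With
  \<open>s = q (1 - a / R)\<close>, the assumption reads \<open>b \<le> a (1 - s)\<close> and the claim
  \<open>b (1 + s) \<le> a\<close>.
\<close>

lemma contraction_hyperbolic_step: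
  fixes a b q R :: real
  assumes "0 \<le> q" and "0 \<le> a" and "a < R"
    and step: "b \<le> (1 - q) * a + q / R * a\<^sup>2"
  shows "b * ((1 + q) * (R - a)) \<le> (R - b) * a"
proof -
  have "0 < R" using assms by linarith
  define s where "s = q * (1 - a / R)"
  have s: "(1 - q) * a + q / R * a\<^sup>2 = a * (1 - s)"
    using \<open>0 < R\<close> by (simp add: s_def field_simps power2_eq_square)
  have "0 \<le> s"
    using assms \<open>0 < R\<close> by (auto simp: s_def intro!: mult_nonneg_nonneg)
  have "(1 + q) * (R - a) + a = R * (1 + s)"
    using \<open>0 < R\<close> by (simp add: s_def field_simps)
  then have "b * ((1 + q) * (R - a) + a) = b * (R * (1 + s))"
    by simp
  also have "\<dots> \<le> a * (1 - s) * (R * (1 + s))"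
    using step s \<open>0 < R\<close> \<open>0 \<le> s\<close> by (intro mult_right_mono) auto
  also have "\<dots> = a * R * (1 - s\<^sup>2)"
    by (simp add: algebra_simps power2_eq_square)
  also have "\<dots> \<le> a * R * 1"
    using assms \<open>0 < R\<close> by (intro mult_left_mono) auto
  finally show ?thesis by (simp add: algebra_simps)
qed

lemma contraction_next_le:
  fixes a b q R :: real
  assumes "0 \<le> q" and "0 \<le> a" and "a < R"
    and step: "b \<le> (1 - q) * a + q / R * a\<^sup>2"
  shows "b \<le> a"
proof -
  have "q * a * (a / R) \<le> q * a * 1"
    using assms by (intro mult_left_mono) auto
  then show ?thesis
    using step by (simp add: power2_eq_square algebra_simps)
qed

text \<open>
  The induction step for the invariant \<open>C \<le> r0 (R / r\<^sub>n - 1)\<close>, where \<open>C\<close> stands for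
  \<open>(1 + q)\<^sup>n (R - r0)\<close>.
\<close>

lemma hyperbolic_invariant_step:
  fixes a b q R r0 C :: real
  assumes "0 \<le> q" and "0 \<le> a" and "a < R" and "0 \<le> b" and "0 \<le> r0"
    and step: "b \<le> (1 - q) * a + q / R * a\<^sup>2"
    and inv: "a * C \<le> (R - a) * r0"
  shows "b * ((1 + q) * C) \<le> (R - b) * r0"
proof (cases "a = 0")
  case True
  \<comment> \<open>The recursion keeps a vanishing distance at zero.\<close>
  then show ?thesis using assms by simp
next
  case False
  have "b \<le> a" by (rule contraction_next_le[OF assms(1-3) step])
  \<comment> \<open>Multiply by \<open>a (R - a)\<close>, which is positive here, and cancel it at the end.\<close>
  have "(b * ((1 + q) * C)) * (a * (R - a)) = (b * ((1 + q) * (R - a))) * (a * C)"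
    by (simp add: mult_ac)
  also have "\<dots> \<le> (b * ((1 + q) * (R - a))) * ((R - a) * r0)"
    using inv assms by (intro mult_left_mono) auto
  also have "\<dots> \<le> ((R - b) * a) * ((R - a) * r0)"
    using contraction_hyperbolic_step[OF assms(1-3) step] assms
    by (intro mult_right_mono) auto
  also have "\<dots> = (R - b) * r0 * (a * (R - a))"
    by (simp add: mult_ac)
  finally show ?thesis
    using False assms by (simp add: mult_le_cancel_right)
qed

text \<open>
  The recursion is only assumed while \<open>r n \<le> r 0\<close>, since the estimates behind it hold only
  near the saddle; the induction therefore carries the localization along with the invariant. The
  final bound discards the summand \<open>r n * r 0\<close> from the invariant.
\<close>

lemma quadratic_recursion_bound:
  fixes r :: "nat \<Rightarrow> real" and q R :: real
  assumes "0 \<le> q" and nonneg: "\<And>n. 0 \<le> r n" and "r 0 < R"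
    and step: "\<And>n. r n \<le> r 0 \<Longrightarrow> r (Suc n) \<le> (1 - q) * r n + q / R * (r n)\<^sup>2"
  shows "r n \<le> (1 / (1 + q)) ^ n * (R * r 0 / (R - r 0))"
proof -
  have "r n \<le> r 0 \<and> r n * ((1 + q) ^ n * (R - r 0)) \<le> (R - r n) * r 0" for n
  proof (induction n)
    case 0
    then show ?case by (simp add: mult.commute)
  next
    case (Suc n)
    then have "r n < R" using \<open>r 0 < R\<close> by linarith
    note st = step[OF conjunct1[OF Suc]]
    have "r (Suc n) \<le> r n"
      by (rule contraction_next_le[OF \<open>0 \<le> q\<close> nonneg \<open>r n < R\<close> st])
    with hyperbolic_invariant_step[OF \<open>0 \<le> q\<close> nonneg \<open>r n < R\<close> nonneg nonneg st
        conjunct2[OF Suc]] Suc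
    show ?case by (simp add: mult_ac)
  qed
  then have "r n * ((1 + q) ^ n * (R - r 0)) \<le> (R - r n) * r 0" by blast
  also have "\<dots> \<le> R * r 0"
    using nonneg by (intro mult_right_mono) auto
  finally show ?thesis
    using \<open>0 \<le> q\<close> \<open>r 0 < R\<close> by (simp add: field_simps power_divide)
qed

section \<open>Convergence of the saddle search\<close>

text \<open>
  The new error splits into the contracted old error and the reflected linearization error. The
  linearization is taken at the current point \<open>y\<close>, not at the saddle, because only the eigenvectors
  of the Hessian at \<open>y\<close> are known to the iteration.
\<close>

lemma saddle_search_one_step:
  fixes E :: "real ^ 'n \<Rightarrow> real"
  assumes "twice_differentiable E" and "k \<le> CARD('n)" and crit: "grad E xstar = 0"
    and y: "y \<in> ball xstar \<delta>"
    and lip: "\<forall>y\<in>ball xstar \<delta>. \<forall>z\<in>ball xstar \<delta>.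
           op_norm (hessian E y - hessian E z) \<le> M * norm (y - z)"
    and "0 < \<mu>" and "\<mu> \<le> L"
    and l: "eigenvalues_of (hessian E y) l" "\<forall>i\<in>{1..k}. l i < 0"
      "\<forall>i\<in>{k+1..CARD('n)}. 0 < l i" "\<forall>i\<in>{1..CARD('n)}. \<bar>l i\<bar> \<in> {\<mu>..L}"
    and sys: "orthonormal_eigensystem (hessian E y) lam v"
  shows "norm (y - (2 / (L + \<mu>)) *\<^sub>R (reflection k v *v grad E y) - xstar)
    \<le> (L - \<mu>) / (L + \<mu>) * norm (y - xstar) + M / (L + \<mu>) * (norm (y - xstar))\<^sup>2"
proof -
  let ?\<beta> = "2 / (L + \<mu>)" and ?H = "hessian E y" and ?R = "reflection k v" and ?w = "y - xstar"
  have "0 < \<delta>" using y by (metis ball_eq_empty empty_iff not_le)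
  have eig: "lam i = l i" if "i \<in> {1..CARD('n)}" for i
    using eigenvalues_of_unique[OF _ l(1) that] sys by (simp add: orthonormal_eigensystem_def)
  have contr: "norm (?w - ?\<beta> *\<^sub>R (?R *v (?H *v ?w))) \<le> (L - \<mu>) / (L + \<mu>) * norm ?w"
    using l \<open>k \<le> CARD('n)\<close>
    by (intro reflected_step_contracts[OF sys \<open>k \<le> CARD('n)\<close> \<open>0 < \<mu>\<close> \<open>\<mu> \<le> L\<close>]) (auto simp: eig)
  have "norm (grad E xstar - grad E y - ?H *v (xstar - y)) \<le> M / 2 * (norm (xstar - y))\<^sup>2"
  proof (rule linearization_error_le[where S = "ball xstar \<delta>" and f' = "\<lambda>u h. hessian E u *v h"])
    fix u h assume u: "u \<in> ball xstar \<delta>"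
    show "(grad E has_derivative (*v) (hessian E u)) (at u)"
      by (rule twice_differentiable_hessian[OF assms(1)])
    have "norm ((hessian E u - ?H) *v h) \<le> op_norm (hessian E u - ?H) * norm h"
      unfolding op_norm_def by (rule onorm) (rule matrix_vector_mul_bounded_linear)
    also have "\<dots> \<le> M * norm (u - y) * norm h"
      using lip u y by (intro mult_right_mono) auto
    finally show "norm (hessian E u *v h - ?H *v h) \<le> M * norm (u - y) * norm h"
      by (simp add: matrix_vector_mult_diff_rdistrib)
  qed (use y \<open>0 < \<delta>\<close> in auto)
  moreover have "grad E xstar - grad E y - ?H *v (xstar - y) = ?H *v ?w - grad E y"
    by (simp add: crit matrix_vector_mult_diff_distrib)
  ultimately have err: "norm (?H *v ?w - grad E y) \<le> M / 2 * (norm ?w)\<^sup>2"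
    by (simp only: norm_minus_commute[of xstar y])
  have "norm (?R *v (?H *v ?w - grad E y)) \<le> norm (?H *v ?w - grad E y)"
    using sys \<open>k \<le> CARD('n)\<close> unfolding orthonormal_eigensystem_def
    by (intro norm_reflection_le) blast+
  with err have "norm (?R *v (?H *v ?w - grad E y)) \<le> M / 2 * (norm ?w)\<^sup>2" by linarith
  then have "?\<beta> * norm (?R *v (?H *v ?w - grad E y)) \<le> ?\<beta> * (M / 2 * (norm ?w)\<^sup>2)"
    using \<open>0 < \<mu>\<close> \<open>\<mu> \<le> L\<close> by (intro mult_left_mono) auto
  also have "2 / s * (M / 2 * c) = M / s * c" for s c :: real
    by simp
  finally have err': "norm (?\<beta> *\<^sub>R (?R *v (?H *v ?w - grad E y))) \<le> M / (L + \<mu>) * (norm ?w)\<^sup>2"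
    using \<open>0 < \<mu>\<close> \<open>\<mu> \<le> L\<close> by simp
  have "y - ?\<beta> *\<^sub>R (?R *v grad E y) - xstar
      = (?w - ?\<beta> *\<^sub>R (?R *v (?H *v ?w))) + ?\<beta> *\<^sub>R (?R *v (?H *v ?w - grad E y))"
    by (simp add: matrix_vector_mult_diff_distrib[of ?R] scaleR_diff_right)
  then show ?thesis
    using norm_triangle_mono[OF contr err'] by (simp only:)
qed

theorem theorem5p2:
  fixes E :: "real ^ 'n \<Rightarrow> real"
    and k :: nat
    and xstar :: "real ^ 'n"
    and x :: "nat \<Rightarrow> real ^ 'n"
    and lam :: "nat \<Rightarrow> nat \<Rightarrow> real"
    and v :: "nat \<Rightarrow> nat \<Rightarrow> real ^ 'n"
    and \<beta> :: "nat \<Rightarrow> real"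
    and \<delta> M \<mu> L rhat \<kappa> :: real
    and r :: "nat \<Rightarrow> real"
  assumes "twice_differentiable E"
    and "1 \<le> k" and "k \<le> CARD('n)"
    and "nondegenerate_saddle k E xstar"
    and "\<delta> > 0"
    and "x 0 \<in> ball xstar \<delta>"
    and "M > 0"
    and "\<forall>y\<in>ball xstar \<delta>. \<forall>z\<in>ball xstar \<delta>.
           op_norm (hessian E y - hessian E z) \<le> M * norm (y - z)"
    and "0 < \<mu>" and "\<mu> < L"
    and "\<forall>y\<in>ball xstar \<delta>. \<exists>l. eigenvalues_of (hessian E y) l \<and>
           (\<forall>i\<in>{1..k}. l i < 0) \<and> (\<forall>i\<in>{k+1..CARD('n)}. 0 < l i) \<and>
           (\<forall>i\<in>{1..CARD('n)}. \<bar>l i\<bar> \<in> {\<mu>..L})"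
    and "\<forall>n. orthonormal_eigensystem (hessian E (x n)) (lam n) (v n)"
    and "\<forall>n. r n = norm (x n - xstar)"
    and "rhat = 2 * \<mu> / M"
    and "\<kappa> = L / \<mu>"
    and "r 0 < min \<delta> rhat"
    and "\<forall>n. \<beta> n = 2 / (L + \<mu>)"
    and "\<forall>n. x (Suc n) = x n - \<beta> n *\<^sub>R (reflection k (v n) *v grad E (x n))"
  shows "x \<longlonglongrightarrow> xstar \<and>
         (\<forall>n. r n \<le> (1 - 2 / (\<kappa> + 3)) ^ n * (rhat * r 0 / (rhat - r 0)))"
proof -
  define q where "q = 2 * \<mu> / (L + \<mu>)"
  have q: "0 \<le> q" "0 < q"
    using assms(9,10) by (auto simp: q_def)
  have "2 * \<mu> / s / (2 * \<mu> / M) = M / s" for s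
    using assms(7,9) by (cases "s = 0") (auto simp: field_simps)
  then have "q / rhat = M / (L + \<mu>)"
    unfolding q_def assms(14) .
  moreover have "1 - q = (L - \<mu>) / (L + \<mu>)"
    using assms(9,10) by (simp add: q_def field_simps)
  ultimately have coeff: "1 - q = (L - \<mu>) / (L + \<mu>)" "q / rhat = M / (L + \<mu>)"
    by blast+
  have rate: "1 - 2 / (\<kappa> + 3) = 1 / (1 + q)"
  proof -
    have eqs: "\<kappa> + 3 = (L + 3 * \<mu>) / \<mu>" "1 + q = (L + 3 * \<mu>) / (L + \<mu>)"
      using assms(9,10,15) by (auto simp: q_def field_simps)
    show ?thesis unfolding eqs using assms(9,10) by (simp add: field_simps)
  qed
  have step: "r (Suc n) \<le> (1 - q) * r n + q / rhat * (r n)\<^sup>2" if "r n \<le> r 0" for n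
  proof -
    have y: "x n \<in> ball xstar \<delta>"
      using that assms(13,16) by (simp add: dist_norm norm_minus_commute)
    then obtain l where l: "eigenvalues_of (hessian E (x n)) l" "\<forall>i\<in>{1..k}. l i < 0"
      "\<forall>i\<in>{k+1..CARD('n)}. 0 < l i" "\<forall>i\<in>{1..CARD('n)}. \<bar>l i\<bar> \<in> {\<mu>..L}"
      using assms(11) by blast
    have "grad E xstar = 0"
      using assms(4) by (simp add: nondegenerate_saddle_def)
    from saddle_search_one_step[OF assms(1,3) this y assms(8,9) less_imp_le[OF assms(10)] l
        assms(12)[rule_format]]
    show ?thesis
      unfolding coeff using assms(13,17,18) by simp
  qed
  have bound: "r n \<le> (1 / (1 + q)) ^ n * (rhat * r 0 / (rhat - r 0))" for n
    using assms(13,16) by (intro quadratic_recursion_bound q step) auto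
  have "(\<lambda>n. (1 / (1 + q)) ^ n * (rhat * r 0 / (rhat - r 0))) \<longlonglongrightarrow> 0"
    using q by (intro tendsto_mult_left_zero LIMSEQ_realpow_zero) auto
  then have "(\<lambda>n. x n - xstar) \<longlonglongrightarrow> 0"
    by (rule Lim_null_comparison[rotated]) (use bound assms(13) in auto)
  then have "x \<longlonglongrightarrow> xstar"
    using Lim_null by blast
  then show ?thesis
    using bound rate by simp
qed

end
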